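(* Let $R$ be an integral domain with quotient field $K$ and let $P$ and $Q$ be non-zero strongly prime ideals of $R$. Then $P\cap Q$ is a strongly 2-absorbing ideal of $R$.
   Context: Let $R$ be an integral domain with quotient field $K$. A proper ideal $I$ of $R$ is strongly prime if, whenever $xy\in I$ for elements $x,y\in K$, then $x\in I$ or $y\in I$. A proper ideal $I$ of $R$ is 2-absorbing if whenever $a,b,c\in R$ and $abc\in I$, then $ab\in I$ or $ac\in I$ or $bc\in I$. A 2-absorbing ideal $I$ of $R$ is a strongly 2-absorbing ideal if, whenever $xyz\in I$ for elements $x,y,z\in K$, we have $xy\in I$ or $yz\in I$ or $xz\in I$. *)

theory Defs
  imports "HOL-Algebra.Ideal" "HOL-Algebra.RingHom"
begin

(* K is a quotient field of R via the embedding emb. The usual situation of a domain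
   contained in its quotient field is the case where emb is the identity. *)
locale quotient_field = domain R + K: field K for R (structure) and K (structure) +
  fixes emb
  assumes emb_hom: "emb \<in> ring_hom R K"
    and emb_inj: "inj_on emb (carrier R)"
    and fraction: "x \<in> carrier K \<Longrightarrow>
      \<exists>a \<in> carrier R. \<exists>b \<in> carrier R - {\<zero>\<^bsub>R\<^esub>}. x = emb a \<otimes>\<^bsub>K\<^esub> inv\<^bsub>K\<^esub> (emb b)"

definition proper_ideal :: "'a set \<Rightarrow> ('a, 'm) ring_scheme \<Rightarrow> bool" where
  "proper_ideal I R \<longleftrightarrow> ideal I R \<and> I \<noteq> carrier R"

(* An ideal I of R, regarded as a subset of the quotient field, is emb ` I. *)

definition strongly_prime_ideal ::
  "'a set \<Rightarrow> ('a, 'm) ring_scheme \<Rightarrow> ('b, 'n) ring_scheme \<Rightarrow> ('a \<Rightarrow> 'b) \<Rightarrow> bool" where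
  "strongly_prime_ideal I R K emb \<longleftrightarrow> proper_ideal I R \<and>
     (\<forall>x \<in> carrier K. \<forall>y \<in> carrier K.
        x \<otimes>\<^bsub>K\<^esub> y \<in> emb ` I \<longrightarrow> x \<in> emb ` I \<or> y \<in> emb ` I)"

definition two_absorbing_ideal :: "'a set \<Rightarrow> ('a, 'm) ring_scheme \<Rightarrow> bool" where
  "two_absorbing_ideal I R \<longleftrightarrow> proper_ideal I R \<and>
     (\<forall>a \<in> carrier R. \<forall>b \<in> carrier R. \<forall>c \<in> carrier R.
        a \<otimes>\<^bsub>R\<^esub> b \<otimes>\<^bsub>R\<^esub> c \<in> I \<longrightarrow>
        a \<otimes>\<^bsub>R\<^esub> b \<in> I \<or> a \<otimes>\<^bsub>R\<^esub> c \<in> I \<or> b \<otimes>\<^bsub>R\<^esub> c \<in> I)"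

definition strongly_two_absorbing_ideal ::
  "'a set \<Rightarrow> ('a, 'm) ring_scheme \<Rightarrow> ('b, 'n) ring_scheme \<Rightarrow> ('a \<Rightarrow> 'b) \<Rightarrow> bool" where
  "strongly_two_absorbing_ideal I R K emb \<longleftrightarrow> two_absorbing_ideal I R \<and>
     (\<forall>x \<in> carrier K. \<forall>y \<in> carrier K. \<forall>z \<in> carrier K.
        x \<otimes>\<^bsub>K\<^esub> y \<otimes>\<^bsub>K\<^esub> z \<in> emb ` I \<longrightarrow>
        x \<otimes>\<^bsub>K\<^esub> y \<in> emb ` I \<or> y \<otimes>\<^bsub>K\<^esub> z \<in> emb ` I \<or> x \<otimes>\<^bsub>K\<^esub> z \<in> emb ` I)"

end

(* If some factor of xyz lies in neither P nor Q, strong primeness puts the product of the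
   other two in both ideals. Otherwise all three factors lie in R, and one of them lies in P
   and a different one in Q. *)
theory Submission
  imports Defs
begin

lemma proper_ideal_subset: "proper_ideal I R \<Longrightarrow> I \<subseteq> carrier R"
  unfolding proper_ideal_def by (auto intro: ideal.Icarr)

lemma (in ring) proper_ideal_Int:
  assumes "proper_ideal P R" "proper_ideal Q R"
  shows "proper_ideal (P \<inter> Q) R"
  using assms i_intersect[of P Q] proper_ideal_subset[OF assms(1)] proper_ideal_subset[OF assms(2)]
  unfolding proper_ideal_def by blast

context quotient_field
begin

lemma emb_closed: "a \<in> carrier R \<Longrightarrow> emb a \<in> carrier K"
  using emb_hom by (rule ring_hom_closed)

lemma emb_mult:
  "a \<in> carrier R \<Longrightarrow> b \<in> carrier R \<Longrightarrow> emb (a \<otimes> b) = emb a \<otimes>\<^bsub>K\<^esub> emb b"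
  using emb_hom by (rule ring_hom_mult)

lemma emb_image_iff:
  "I \<subseteq> carrier R \<Longrightarrow> a \<in> carrier R \<Longrightarrow> emb a \<in> emb ` I \<longleftrightarrow> a \<in> I"
  using inj_on_image_mem_iff[OF emb_inj] by blast

text \<open>Injectivity of \<open>emb\<close> supplies the inclusion from right to left. Membership
  in the intersection can then be tested inside K for each ideal separately, which is how strong
  primeness of P and of Q is brought to bear.\<close>

lemma image_emb_Int:
  "I \<subseteq> carrier R \<Longrightarrow> J \<subseteq> carrier R \<Longrightarrow> emb ` (I \<inter> J) = emb ` I \<inter> emb ` J"
  using inj_on_image_Int[OF emb_inj] .

text \<open>Absorption works from both sides: P absorbs the factor from Q and Q absorbs the factor
  from P, both being elements of R. This finishes the case in which two different factors are found,
  one in each ideal.\<close>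

lemma mult_mem_image_Int:
  assumes "ideal P R" "ideal Q R" "x \<in> emb ` P" "y \<in> emb ` Q"
  shows "x \<otimes>\<^bsub>K\<^esub> y \<in> emb ` (P \<inter> Q)"
proof -
  obtain a b where ab: "a \<in> P" "x = emb a" "b \<in> Q" "y = emb b"
    using assms by blast
  have car: "a \<in> carrier R" "b \<in> carrier R"
    using ideal.Icarr[OF assms(1)] ideal.Icarr[OF assms(2)] ab by blast+
  have "a \<otimes> b \<in> P \<inter> Q"
    using ideal.I_r_closed[OF assms(1)] ideal.I_l_closed[OF assms(2)] ab car by blast
  then show ?thesis
    using emb_mult[OF car] ab by force
qed

text \<open>The condition on triples in K already contains the 2-absorbing condition on R: apply it
  to \<open>emb a\<close>, \<open>emb b\<close>, \<open>emb c\<close> and pull the result back along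
  the injective \<open>emb\<close>.\<close>

lemma strongly_two_absorbing_idealI:
  assumes I: "proper_ideal I R"
    and abs: "\<And>x y z. \<lbrakk>x \<in> carrier K; y \<in> carrier K; z \<in> carrier K;
      x \<otimes>\<^bsub>K\<^esub> y \<otimes>\<^bsub>K\<^esub> z \<in> emb ` I\<rbrakk> \<Longrightarrow>
      x \<otimes>\<^bsub>K\<^esub> y \<in> emb ` I \<or> y \<otimes>\<^bsub>K\<^esub> z \<in> emb ` I \<or> x \<otimes>\<^bsub>K\<^esub> z \<in> emb ` I"
  shows "strongly_two_absorbing_ideal I R K emb"
proof -
  have sub: "I \<subseteq> carrier R"
    using I by (rule proper_ideal_subset)
  have "a \<otimes> b \<in> I \<or> a \<otimes> c \<in> I \<or> b \<otimes> c \<in> I"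
    if car: "a \<in> carrier R" "b \<in> carrier R" "c \<in> carrier R" and "a \<otimes> b \<otimes> c \<in> I" for a b c
  proof -
    have "emb a \<otimes>\<^bsub>K\<^esub> emb b \<otimes>\<^bsub>K\<^esub> emb c \<in> emb ` I"
      using that by (simp flip: emb_mult)
    then have "emb (a \<otimes> b) \<in> emb ` I \<or> emb (b \<otimes> c) \<in> emb ` I \<or> emb (a \<otimes> c) \<in> emb ` I"
      using abs[of "emb a" "emb b" "emb c"] car by (simp add: emb_closed emb_mult)
    then show ?thesis
      using emb_image_iff[OF sub] car by auto
  qed
  then show ?thesis
    unfolding strongly_two_absorbing_ideal_def two_absorbing_ideal_def
    by (intro conjI ballI impI I abs)
qed

lemma strongly_prime_ideal_Int:
  assumes P: "strongly_prime_ideal P R K emb" and Q: "strongly_prime_ideal Q R K emb"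
  shows "strongly_two_absorbing_ideal (P \<inter> Q) R K emb"
proof (rule strongly_two_absorbing_idealI)
  have proper: "proper_ideal P R" "proper_ideal Q R"
    and primeP: "\<And>x y. \<lbrakk>x \<in> carrier K; y \<in> carrier K; x \<otimes>\<^bsub>K\<^esub> y \<in> emb ` P\<rbrakk> \<Longrightarrow>
      x \<in> emb ` P \<or> y \<in> emb ` P"
    and primeQ: "\<And>x y. \<lbrakk>x \<in> carrier K; y \<in> carrier K; x \<otimes>\<^bsub>K\<^esub> y \<in> emb ` Q\<rbrakk> \<Longrightarrow>
      x \<in> emb ` Q \<or> y \<in> emb ` Q"
    using P Q unfolding strongly_prime_ideal_def by blast+
  show "proper_ideal (P \<inter> Q) R"
    using proper by (rule proper_ideal_Int)
  have ideals: "ideal P R" "ideal Q R"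
    using proper unfolding proper_ideal_def by blast+
  have Int: "emb ` (P \<inter> Q) = emb ` P \<inter> emb ` Q"
    using proper[THEN proper_ideal_subset] by (rule image_emb_Int)
  fix x y z
  assume car: "x \<in> carrier K" "y \<in> carrier K" "z \<in> carrier K"
    and xyz: "x \<otimes>\<^bsub>K\<^esub> y \<otimes>\<^bsub>K\<^esub> z \<in> emb ` (P \<inter> Q)"
  \<comment> \<open>Since u avoids both ideals, primeness of P forces v into P and primeness of Q
    forces v into Q.\<close>
  have cofactor: "v \<in> emb ` (P \<inter> Q)"
    if "u \<in> carrier K" "v \<in> carrier K" "u \<otimes>\<^bsub>K\<^esub> v \<in> emb ` (P \<inter> Q)" "u \<notin> emb ` P \<union> emb ` Q"
    for u v
    using primeP[of u v] primeQ[of u v] that unfolding Int by blast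
  \<comment> \<open>Each factor in turn is split off on the left, to serve as u in
    \<open>cofactor\<close>.\<close>
  have perm: "x \<otimes>\<^bsub>K\<^esub> (y \<otimes>\<^bsub>K\<^esub> z) = x \<otimes>\<^bsub>K\<^esub> y \<otimes>\<^bsub>K\<^esub> z"
    "y \<otimes>\<^bsub>K\<^esub> (x \<otimes>\<^bsub>K\<^esub> z) = x \<otimes>\<^bsub>K\<^esub> y \<otimes>\<^bsub>K\<^esub> z"
    "z \<otimes>\<^bsub>K\<^esub> (x \<otimes>\<^bsub>K\<^esub> y) = x \<otimes>\<^bsub>K\<^esub> y \<otimes>\<^bsub>K\<^esub> z"
    using car by (simp_all add: K.m_ac)
  \<comment> \<open>\<open>mult_mem_image_Int\<close> puts the factor from P on the left; these
    equations restore the order of the goal.\<close>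
  have comm: "y \<otimes>\<^bsub>K\<^esub> x = x \<otimes>\<^bsub>K\<^esub> y" "z \<otimes>\<^bsub>K\<^esub> x = x \<otimes>\<^bsub>K\<^esub> z" "z \<otimes>\<^bsub>K\<^esub> y = y \<otimes>\<^bsub>K\<^esub> z"
    using car by (simp_all add: K.m_comm)
  show "x \<otimes>\<^bsub>K\<^esub> y \<in> emb ` (P \<inter> Q) \<or> y \<otimes>\<^bsub>K\<^esub> z \<in> emb ` (P \<inter> Q) \<or> x \<otimes>\<^bsub>K\<^esub> z \<in> emb ` (P \<inter> Q)"
  proof (cases "{x, y, z} \<subseteq> emb ` P \<union> emb ` Q")
    case False
    then show ?thesis
      using cofactor[of x "y \<otimes>\<^bsub>K\<^esub> z"] cofactor[of y "x \<otimes>\<^bsub>K\<^esub> z"] cofactor[of z "x \<otimes>\<^bsub>K\<^esub> y"]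
        car xyz perm by auto
  next
    case True
    \<comment> \<open>For each ideal, primeness is applied first to (xy)z and then to xy.\<close>
    have "x \<in> emb ` P \<or> y \<in> emb ` P \<or> z \<in> emb ` P" "x \<in> emb ` Q \<or> y \<in> emb ` Q \<or> z \<in> emb ` Q"
      using primeP[of "x \<otimes>\<^bsub>K\<^esub> y" z] primeP[of x y] primeQ[of "x \<otimes>\<^bsub>K\<^esub> y" z] primeQ[of x y]
        car xyz K.m_closed unfolding Int by blast+
    \<comment> \<open>If one factor is the witness for both P and Q, any other factor lies in P or
      in Q by the case assumption, and the shared witness serves for the remaining ideal.\<close>
    with True have "x \<in> emb ` P \<and> y \<in> emb ` Q \<or> y \<in> emb ` P \<and> x \<in> emb ` Q \<or>
      y \<in> emb ` P \<and> z \<in> emb ` Q \<or> z \<in> emb ` P \<and> y \<in> emb ` Q \<or>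
      x \<in> emb ` P \<and> z \<in> emb ` Q \<or> z \<in> emb ` P \<and> x \<in> emb ` Q"
      by blast
    then show ?thesis
      using mult_mem_image_Int[OF ideals] comm by metis
  qed
qed

end

theorem theorem3p16:
  fixes R :: "('a, 'm) ring_scheme" and K :: "('b, 'n) ring_scheme" and emb :: "'a \<Rightarrow> 'b"
    and P Q :: "'a set"
  assumes "quotient_field R K emb"
    and "strongly_prime_ideal P R K emb" and "P \<noteq> {\<zero>\<^bsub>R\<^esub>}"
    and "strongly_prime_ideal Q R K emb" and "Q \<noteq> {\<zero>\<^bsub>R\<^esub>}"
  shows "strongly_two_absorbing_ideal (P \<inter> Q) R K emb"
  using assms(1,2,4) by (rule quotient_field.strongly_prime_ideal_Int)

end
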